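(* Let $\rho$ be a probability distribution on $\mathcal S$, let $\pi^*$ be an optimal robust policy, and let $M=\sup_{u\in\mathcal U}\|d_\rho^{\pi^*,u}/\rho\|_\infty$ (finite whenever $\mathrm{supp}(\rho)=\mathcal S$; assume $M<\infty$). Let $(\pi_k)$ be generated by the robust policy mirror descent (RPMD) method with distance-generating function $w(\cdot)=\|\cdot\|_2^2$ and constant stepsizes $\eta_t=\eta$ for all $t\ge0$, where $\eta>0$ is arbitrary. Then for every $k\ge1$, $$f_\rho(\pi_k)-f_\rho(\pi^* )\ \le\ \frac{M}{(1-\gamma)k}\big(f_\rho(\pi_0)-f_\rho(\pi^* )\big)+\sqrt{\frac{18|\mathcal S|^2}{\eta k(1-\gamma)^3}} .$$
   Context: Robust MDP. $\mathcal S,\mathcal A$ are finite nonempty state and action sets, $c:\mathcal S\times\mathcal A\to\mathbb R$ is a cost with $0<c(s,a)\le1$, $\gamma\in(0,1)$ is the discount factor, and $\mathbb P_{N}$ is a nominal transition kernel ($\mathbb P_N(\cdot|s,a)\in\Delta_{\mathcal S}$, where $\Delta_{\mathcal X}$ is the probability simplex over $\mathcal X$). The uncertainty set $\mathcal U\subset\mathbb R^{|\mathcal S|\times|\mathcal S|\times|\mathcal A|}$ is nonempty, compact and $(s,a)$-rectangular: $\mathcal U=\prod_{s,a}\mathcal U_{s,a}$ with $\mathcal U_{s,a}=\{u(\cdot|s,a):u\in\mathcal U\}$; for every $u\in\mathcal U$, $\mathbb P_u(\cdot|s,a)=\mathbb P_N(\cdot|s,a)+u(\cdot|s,a)$ is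 a transition kernel. $\Pi$ is the set of stationary randomized policies ($\pi(\cdot|s)\in\Delta_{\mathcal A}$ for all $s$). Values. $V^\pi_u(s)=\mathbb E[\sum_{t\ge0}\gamma^t c(s_t,a_t)\mid s_0=s]$ with $a_t\sim\pi(\cdot|s_t)$, $s_{t+1}\sim\mathbb P_u(\cdot|s_t,a_t)$; $Q^\pi_u(s,a)$ is the same with in addition $a_0=a$. Robust values: $V^\pi_r(s)=\max_{u\in\mathcal U}V^\pi_u(s)$, $Q^\pi_r(s,a)=\max_{u\in\mathcal U}Q^\pi_u(s,a)$. Objective: $f_\rho(\pi)=\mathbb E_{s\sim\rho}[V^\pi_r(s)]$. An optimal robust policy $\pi^*$ satisfies $V^{\pi^*}_r(s)\le V^\pi_r(s)$ for all $s\in\mathcal S$, $\pi\in\Pi$ (such a policy exists). Visitation measures: $d^{\pi,u}_s(s')=(1-\gamma)\sum_{t\ge0}\gamma^t\Pr(s_t=s'\mid s_0=s)$ under policy $\pi$ and kernel $\mathbb P_u$; $d^{\pi,u}_\rho(s')=\mathbb E_{s\sim\rho}d^{\pi,u}_s(s')$. Ratios of measures are taken entrywise. RPMD with $w=\|\cdot\|_2^2$. The Bregman divergence is $D^\pi_{\pi'}(s)=\|\pi(\cdot|s)-\pi'(\cdot|s)\|_2^2$. Given $\pi_0\in\Pi$, RPMD sets, for every $s\in\mathcal S$ and $k\ge 0$, $$\pi_{k+1}(\cdot|s)=\operatorname{argmin}_{p(\cdot|s)\in\Delta_{\mathcal A}}\ \eta_k\langle Q^{\pi_k}_r(s,\cdot),p(\cdot|s)\rangle+\|p(\cdot|s)-\pi_k(\cdot|s)\|_2^2.$$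 *)

theory Defs
  imports "HOL-Probability.Probability"
begin

type_synonym ('s, 'a) policy = "'s \<Rightarrow> real ^ 'a"
type_synonym ('s, 'a) kernel = "'s \<Rightarrow> 'a \<Rightarrow> real ^ 's"

definition prob_simplex :: "(real ^ 'x) set" where
  "prob_simplex = {p. (\<forall>i. 0 \<le> p $ i) \<and> (\<Sum>i\<in>UNIV. p $ i) = 1}"

definition policies :: "('s::finite, 'a::finite) policy set" where
  "policies = {\<pi>. \<forall>s. \<pi> s \<in> prob_simplex}"

definition transition_kernels :: "('s::finite, 'a::finite) kernel set" where
  "transition_kernels = {P. \<forall>s a. P s a \<in> prob_simplex}"

definition perturbed :: "('s::finite, 'a::finite) kernel \<Rightarrow> ('s, 'a) kernel \<Rightarrow> ('s, 'a) kernel" where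
  "perturbed PN u = (\<lambda>s a. PN s a + u s a)"

definition rectangular :: "('s::finite, 'a::finite) kernel set \<Rightarrow> bool" where
  "rectangular U \<longleftrightarrow> U = {u. \<forall>s a. u s a \<in> (\<lambda>v. v s a) ` U}"

text \<open>The probability mass function of a point of the simplex; unspecified outside of the simplex.\<close>

definition vec_pmf :: "real ^ 'x \<Rightarrow> 'x pmf" where
  "vec_pmf p = embed_pmf (\<lambda>i. p $ i)"

definition initial_state :: "('s::finite, 'a::finite) policy \<Rightarrow> 's \<Rightarrow> ('s \<times> 'a) pmf" where
  "initial_state \<pi> s = map_pmf (\<lambda>a. (s, a)) (vec_pmf (\<pi> s))"

definition next_pair ::
    "('s::finite, 'a::finite) policy \<Rightarrow> ('s, 'a) kernel \<Rightarrow> 's \<times> 'a \<Rightarrow> ('s \<times> 'a) pmf" where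
  "next_pair \<pi> P x = bind_pmf (vec_pmf (P (fst x) (snd x))) (initial_state \<pi>)"

fun process_step ::
    "('s::finite \<times> 'a::finite) pmf \<Rightarrow> ('s, 'a) policy \<Rightarrow> ('s, 'a) kernel \<Rightarrow> nat \<Rightarrow>
     (nat \<Rightarrow> 's \<times> 'a) \<Rightarrow> ('s \<times> 'a) measure" where
  "process_step \<mu> \<pi> P 0 \<omega> = measure_pmf \<mu>"
| "process_step \<mu> \<pi> P (Suc t) \<omega> = measure_pmf (next_pair \<pi> P (\<omega> t))"

lemma Ionescu_Tulcea_process:
  fixes \<mu> :: "('s::finite \<times> 'a::finite) pmf"
  shows "Ionescu_Tulcea (process_step \<mu> \<pi> P) (\<lambda>_. count_space UNIV)"
proof (rule Ionescu_Tulcea.intro)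
  fix i
  show "process_step \<mu> \<pi> P i \<in> measurable (PiM {0..<i} (\<lambda>_. count_space UNIV))
      (subprob_algebra (count_space UNIV))"
  proof (cases i)
    case 0
    then show ?thesis
      by (auto simp: process_step.simps[abs_def] space_subprob_algebra
          intro!: measurable_const prob_space_imp_subprob_space prob_space_measure_pmf)
  next
    case (Suc t)
    have "(\<lambda>\<omega>. \<omega> t) \<in> measurable (PiM {0..<i} (\<lambda>_. count_space UNIV)) (count_space UNIV)"
      using Suc by (intro measurable_component_singleton) auto
    moreover have "(\<lambda>x. measure_pmf (next_pair \<pi> P x)) \<in>
        measurable (count_space UNIV) (subprob_algebra (count_space UNIV))"
      by (auto simp: space_subprob_algebra
          intro!: prob_space_imp_subprob_space prob_space_measure_pmf)
    ultimately have "(\<lambda>\<omega>. measure_pmf (next_pair \<pi> P (\<omega> t))) \<in>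
        measurable (PiM {0..<i} (\<lambda>_. count_space UNIV)) (subprob_algebra (count_space UNIV))"
      by (rule measurable_compose)
    then show ?thesis
      by (simp add: Suc process_step.simps[abs_def])
  qed
next
  fix i :: nat and \<omega> :: "nat \<Rightarrow> 's \<times> 'a"
  show "prob_space (process_step \<mu> \<pi> P i \<omega>)"
    by (cases i) (auto intro: prob_space_measure_pmf)
qed

text \<open>
  The law of the process \<open>(s\<^sub>t, a\<^sub>t)\<close>, \<open>t \<ge> 0\<close>, where \<open>(s\<^sub>0, a\<^sub>0)\<close> has distribution \<open>\<mu>\<close>,
  \<open>s\<^bsub>t+1\<^esub>\<close> is drawn from \<open>P s\<^sub>t a\<^sub>t\<close> and \<open>a\<^bsub>t+1\<^esub>\<close> from \<open>\<pi> s\<^bsub>t+1\<^esub>\<close>. It is the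
  Ionescu-Tulcea measure on infinite trajectories, i.e. the constant \<open>PF.lim\<close> of the locale
  \<open>Ionescu_Tulcea\<close>, written out without an interpretation.
\<close>

definition trajectories ::
    "('s::finite \<times> 'a::finite) pmf \<Rightarrow> ('s, 'a) policy \<Rightarrow> ('s, 'a) kernel \<Rightarrow>
     (nat \<Rightarrow> 's \<times> 'a) measure" where
  "trajectories \<mu> \<pi> P = projective_family.lim UNIV
     (Ionescu_Tulcea.CI (process_step \<mu> \<pi> P) (\<lambda>_. count_space UNIV)) (\<lambda>_. count_space UNIV)"

definition discounted_cost ::
    "real \<Rightarrow> ('s \<Rightarrow> 'a \<Rightarrow> real) \<Rightarrow> (nat \<Rightarrow> 's \<times> 'a) \<Rightarrow> real" where
  "discounted_cost \<gamma> c \<omega> = (\<Sum>t. \<gamma> ^ t * c (fst (\<omega> t)) (snd (\<omega> t)))"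

definition V_value ::
    "real \<Rightarrow> ('s::finite \<Rightarrow> 'a::finite \<Rightarrow> real) \<Rightarrow> ('s, 'a) policy \<Rightarrow> ('s, 'a) kernel \<Rightarrow>
     's \<Rightarrow> real" where
  "V_value \<gamma> c \<pi> P s = (\<integral>\<omega>. discounted_cost \<gamma> c \<omega> \<partial>trajectories (initial_state \<pi> s) \<pi> P)"

definition Q_value ::
    "real \<Rightarrow> ('s::finite \<Rightarrow> 'a::finite \<Rightarrow> real) \<Rightarrow> ('s, 'a) policy \<Rightarrow> ('s, 'a) kernel \<Rightarrow>
     's \<Rightarrow> 'a \<Rightarrow> real" where
  "Q_value \<gamma> c \<pi> P s a = (\<integral>\<omega>. discounted_cost \<gamma> c \<omega> \<partial>trajectories (return_pmf (s, a)) \<pi> P)"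

text \<open>
  The robust values are maxima over the uncertainty set. They are written as suprema, which are
  attained when the set is nonempty and compact and all perturbed kernels are transition kernels.
\<close>

definition V_robust ::
    "real \<Rightarrow> ('s::finite \<Rightarrow> 'a::finite \<Rightarrow> real) \<Rightarrow> ('s, 'a) kernel \<Rightarrow> ('s, 'a) kernel set \<Rightarrow>
     ('s, 'a) policy \<Rightarrow> 's \<Rightarrow> real" where
  "V_robust \<gamma> c PN U \<pi> s = (SUP u\<in>U. V_value \<gamma> c \<pi> (perturbed PN u) s)"

definition Q_robust ::
    "real \<Rightarrow> ('s::finite \<Rightarrow> 'a::finite \<Rightarrow> real) \<Rightarrow> ('s, 'a) kernel \<Rightarrow> ('s, 'a) kernel set \<Rightarrow>
     ('s, 'a) policy \<Rightarrow> 's \<Rightarrow> real ^ 'a" where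
  "Q_robust \<gamma> c PN U \<pi> s = (\<chi> a. SUP u\<in>U. Q_value \<gamma> c \<pi> (perturbed PN u) s a)"

definition robust_objective ::
    "real \<Rightarrow> ('s::finite \<Rightarrow> 'a::finite \<Rightarrow> real) \<Rightarrow> ('s, 'a) kernel \<Rightarrow> ('s, 'a) kernel set \<Rightarrow>
     real ^ 's \<Rightarrow> ('s, 'a) policy \<Rightarrow> real" where
  "robust_objective \<gamma> c PN U \<rho> \<pi> = (\<Sum>s\<in>UNIV. \<rho> $ s * V_robust \<gamma> c PN U \<pi> s)"

definition optimal_robust_policy ::
    "real \<Rightarrow> ('s::finite \<Rightarrow> 'a::finite \<Rightarrow> real) \<Rightarrow> ('s, 'a) kernel \<Rightarrow> ('s, 'a) kernel set \<Rightarrow>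
     ('s, 'a) policy \<Rightarrow> bool" where
  "optimal_robust_policy \<gamma> c PN U \<pi>opt \<longleftrightarrow> \<pi>opt \<in> policies \<and>
     (\<forall>\<pi>\<in>policies. \<forall>s. V_robust \<gamma> c PN U \<pi>opt s \<le> V_robust \<gamma> c PN U \<pi> s)"

definition visitation_from ::
    "real \<Rightarrow> ('s::finite, 'a::finite) policy \<Rightarrow> ('s, 'a) kernel \<Rightarrow> 's \<Rightarrow> 's \<Rightarrow> real" where
  "visitation_from \<gamma> \<pi> P s s' =
     (1 - \<gamma>) * (\<Sum>t. \<gamma> ^ t *
       (let T = trajectories (initial_state \<pi> s) \<pi> P
        in measure T {\<omega> \<in> space T. fst (\<omega> t) = s'}))"

definition visitation ::
    "real \<Rightarrow> ('s::finite, 'a::finite) policy \<Rightarrow> ('s, 'a) kernel \<Rightarrow> real ^ 's \<Rightarrow> 's \<Rightarrow> real" where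
  "visitation \<gamma> \<pi> P \<rho> s' = (\<Sum>s\<in>UNIV. \<rho> $ s * visitation_from \<gamma> \<pi> P s s')"

text \<open>
  Ratios are taken in \<open>ennreal\<close>, so that the value is infinite when the visitation measure
  charges a state outside of the support of \<open>\<rho>\<close>, while \<open>0 / 0 = 0\<close>.
\<close>

definition mismatch_coefficient ::
    "real \<Rightarrow> ('s::finite, 'a::finite) kernel \<Rightarrow> ('s, 'a) kernel set \<Rightarrow> real ^ 's \<Rightarrow>
     ('s, 'a) policy \<Rightarrow> ennreal" where
  "mismatch_coefficient \<gamma> PN U \<rho> \<pi> =
     (SUP u\<in>U. SUP s. ennreal (visitation \<gamma> \<pi> (perturbed PN u) \<rho> s) / ennreal (\<rho> $ s))"

definition bregman :: "('s, 'a::finite) policy \<Rightarrow> ('s, 'a) policy \<Rightarrow> 's \<Rightarrow> real" where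
  "bregman \<pi> \<pi>' s = (norm (\<pi> s - \<pi>' s))\<^sup>2"

definition rpmd ::
    "real \<Rightarrow> ('s::finite \<Rightarrow> 'a::finite \<Rightarrow> real) \<Rightarrow> ('s, 'a) kernel \<Rightarrow> ('s, 'a) kernel set \<Rightarrow>
     (nat \<Rightarrow> real) \<Rightarrow> (nat \<Rightarrow> ('s, 'a) policy) \<Rightarrow> bool" where
  "rpmd \<gamma> c PN U \<eta> \<pi> \<longleftrightarrow> \<pi> 0 \<in> policies \<and>
     (\<forall>k s. is_arg_min
        (\<lambda>p. \<eta> k * inner (Q_robust \<gamma> c PN U (\<pi> k) s) p + bregman (\<lambda>_. p) (\<pi> k) s)
        (\<lambda>p. p \<in> prob_simplex) (\<pi> (Suc k) s))"

end

theory Submission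
  imports Defs
begin

text \<open>
  Write \<open>V\<^sub>t\<close>, \<open>Q\<^sub>t\<close> for the robust values of \<open>\<pi>\<^sub>t\<close> and \<open>e\<^sub>t(s) = \<parallel>\<pi>\<^bsub>t+1\<^esub>(s) - \<pi>\<^sub>t(s)\<parallel>\<close>. The variational
  inequality of the prox step, tested with \<open>\<pi>\<^sub>t\<close>, gives
  \<open>2 e\<^sub>t\<^sup>2 / \<eta> \<le> \<langle>Q\<^sub>t, \<pi>\<^sub>t - \<pi>\<^bsub>t+1\<^esub>\<rangle> \<le> V\<^sub>t - V\<^bsub>t+1\<^esub>\<close> at every state; hence the values decrease and
  \<open>\<Sum>\<^sub>t e\<^sub>t\<^sup>2 \<le> \<eta> / (2 (1 - \<gamma>))\<close>. Tested with the optimal policy it gives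
  \<open>\<langle>Q\<^sub>t, \<pi>\<^sub>t - \<pi>\<^sup>*\<rangle> \<le> V\<^sub>t - V\<^bsub>t+1\<^esub> + 4 e\<^sub>t / \<eta>\<close>. By the performance difference inequality, the
  optimality gap is at most \<open>1 / (1 - \<gamma>)\<close> times the average of the left-hand side under the
  visitation measure \<open>d\<^sub>t\<close> of \<open>\<pi>\<^sup>*\<close> for the kernel that is worst for \<open>V\<^sub>t\<close>. This measure depends
  on \<open>t\<close>, so distances to \<open>\<pi>\<^sup>*\<close> do not telescope. Instead \<open>d\<^sub>t \<le> M \<rho>\<close> is used for the
  nonnegative terms \<open>V\<^sub>t - V\<^bsub>t+1\<^esub>\<close>, which telescope, and \<open>d\<^sub>t \<le> 1\<close> for the terms \<open>4 e\<^sub>t / \<eta>\<close>, which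
  are summed by the Cauchy-Schwarz inequality. This yields the constant 8 in place of 18.
\<close>

subsection \<open>Marginals of the trajectory measure\<close>

text \<open>\<open>C 0 (Suc t)\<close> extends a path drawn from \<open>C 0 t\<close> by one
  coordinate with law \<open>P t\<close>, so a function of coordinate \<open>t\<close> sees only
  this last draw.\<close>

lemma (in Ionescu_Tulcea) nn_integral_C_last:
  assumes f [measurable]: "f \<in> borel_measurable (M t)"
  shows "(\<integral>\<^sup>+\<omega>. f (\<omega> t) \<partial>C 0 (Suc t) (\<lambda>_. undefined))
    = (\<integral>\<^sup>+\<omega>. (\<integral>\<^sup>+x. f x \<partial>P t \<omega>) \<partial>C 0 t (\<lambda>_. undefined))"
proof -
  have [simp]: "(\<lambda>_. undefined) \<in> space (PiM {0..<0::nat} M)"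
    by (simp add: space_PiM)
  have [measurable]: "(\<lambda>\<omega>. f (\<omega> t)) \<in> borel_measurable (PiM {0..<Suc t} M)"
    by measurable
  have "(\<integral>\<^sup>+\<omega>. f (\<omega> t) \<partial>C 0 (Suc t) (\<lambda>_. undefined))
      = (\<integral>\<^sup>+\<omega>. (\<integral>\<^sup>+x. f (x t) \<partial>eP t \<omega>) \<partial>C 0 t (\<lambda>_. undefined))"
    by (simp add: nn_integral_bind[where B = "PiM {0..<Suc t} M"]
        measurable_cong_sets[OF sets_C])
  also have "\<dots> = (\<integral>\<^sup>+\<omega>. (\<integral>\<^sup>+x. f x \<partial>P t \<omega>) \<partial>C 0 t (\<lambda>_. undefined))"
    by (intro nn_integral_cong) (auto simp: nn_integral_eP space_C)
  finally show ?thesis .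
qed

text \<open>The limit measure is known through its finite-dimensional projections. Projecting to the
  coordinates below \<open>Suc t\<close> gives \<open>CI\<close>, which is built from
  \<open>C 0 (Suc t)\<close> because \<open>up_to\<close> of this index set is
  \<open>Suc t\<close>.\<close>

lemma (in Ionescu_Tulcea) nn_integral_lim_component:
  assumes f [measurable]: "f \<in> borel_measurable (M t)"
  shows "(\<integral>\<^sup>+\<omega>. f (\<omega> t) \<partial>PF.lim) = (\<integral>\<^sup>+\<omega>. f (\<omega> t) \<partial>C 0 (Suc t) (\<lambda>_. undefined))"
proof -
  let ?J = "{0..<Suc t}"
  have [simp]: "up_to ?J = Suc t"
    using up_to_less[of ?J t] by (intro antisym) (auto simp: up_to_iff)
  have [simp]: "(\<lambda>_. undefined) \<in> space (PiM {0..<0::nat} M)"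
    by (simp add: space_PiM)
  have ft: "(\<lambda>\<omega>. f (\<omega> t)) \<in> borel_measurable (PiM ?J M)"
    by measurable
  have "(\<integral>\<^sup>+\<omega>. f (\<omega> t) \<partial>PF.lim) = (\<integral>\<^sup>+\<omega>. f (restrict \<omega> ?J t) \<partial>PF.lim)"
    by simp
  also have "\<dots> = (\<integral>\<^sup>+\<omega>. f (\<omega> t) \<partial>distr PF.lim (PiM ?J M) (\<lambda>\<omega>. restrict \<omega> ?J))"
    by (subst nn_integral_distr)
      (auto intro!: ft measurable_restrict simp: measurable_cong_sets[OF PF.sets_lim refl])
  also have "\<dots> = (\<integral>\<^sup>+\<omega>. f (\<omega> t) \<partial>CI ?J)"
    by (subst distr_lim) auto
  also have "\<dots> = (\<integral>\<^sup>+\<omega>. f (restrict \<omega> ?J t) \<partial>C 0 (Suc t) (\<lambda>_. undefined))"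
    unfolding CI_def
    by (subst nn_integral_distr)
      (auto intro!: ft measurable_restrict simp: measurable_cong_sets[OF sets_C] simp del: C.simps)
  finally show ?thesis by simp
qed

text \<open>Marginal of the Markov chain at time \<open>t\<close>. Discounted costs and visitation
  measures are series of functions of a single coordinate, so these laws carry all the information
  about trajectories that is used later.\<close>

primrec pair_law ::
    "('s::finite \<times> 'a::finite) pmf \<Rightarrow> ('s, 'a) policy \<Rightarrow> ('s, 'a) kernel \<Rightarrow> nat \<Rightarrow> ('s \<times> 'a) pmf" where
  "pair_law \<mu> \<pi> P 0 = \<mu>"
| "pair_law \<mu> \<pi> P (Suc t) = bind_pmf (pair_law \<mu> \<pi> P t) (next_pair \<pi> P)"

lemma pair_law_bind:
  "pair_law (bind_pmf \<mu> f) \<pi> P t = bind_pmf \<mu> (\<lambda>x. pair_law (f x) \<pi> P t)"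
  by (induction t) (simp_all add: bind_assoc_pmf)

text \<open>The recursion of \<open>pair_law\<close> adds a transition at the end of the path,
  whereas Bellman equations split off the first one.\<close>

lemma pair_law_Suc_shift:
  "pair_law \<mu> \<pi> P (Suc t) = pair_law (bind_pmf \<mu> (next_pair \<pi> P)) \<pi> P t"
  by (induction t) simp_all

lemma sets_trajectories [measurable_cong]:
  "sets (trajectories \<mu> \<pi> P) = sets (PiM UNIV (\<lambda>_. count_space UNIV))"
proof -
  interpret Ionescu_Tulcea "process_step \<mu> \<pi> P" "\<lambda>_. count_space UNIV"
    by (rule Ionescu_Tulcea_process)
  show ?thesis
    unfolding trajectories_def by simp
qed

lemma space_trajectories [simp]: "space (trajectories \<mu> \<pi> P) = UNIV"
  using sets_eq_imp_space_eq[OF sets_trajectories] by (simp add: space_PiM)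

text \<open>Induction with \<open>f\<close> generalised: integrating out the last coordinate against
  \<open>next_pair\<close> leaves a function of the coordinate before it.\<close>

lemma nn_integral_trajectories_component:
  "(\<integral>\<^sup>+\<omega>. f (\<omega> t) \<partial>trajectories \<mu> \<pi> P) = (\<integral>\<^sup>+x. f x \<partial>pair_law \<mu> \<pi> P t)"
proof -
  interpret Ionescu_Tulcea "process_step \<mu> \<pi> P" "\<lambda>_. count_space UNIV"
    by (rule Ionescu_Tulcea_process)
  have [simp]: "(\<lambda>_. undefined) \<in> space (PiM {0..<0::nat} (\<lambda>_. count_space UNIV))"
    by (simp add: space_PiM)
  have "(\<integral>\<^sup>+\<omega>. f (\<omega> t) \<partial>C 0 (Suc t) (\<lambda>_. undefined)) = (\<integral>\<^sup>+x. f x \<partial>pair_law \<mu> \<pi> P t)"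
  proof (induction t arbitrary: f)
    case 0
    show ?case
      by (subst nn_integral_C_last) (simp_all add: prob_space.emeasure_space_1 nn_integral_return)
  next
    case (Suc t)
    show ?case
      by (subst nn_integral_C_last)
        (simp_all del: C.simps add: Suc[of "\<lambda>x. \<integral>\<^sup>+y. f y \<partial>next_pair \<pi> P x"])
  qed
  then show ?thesis
    unfolding trajectories_def by (subst nn_integral_lim_component) (simp_all del: C.simps)
qed

lemma measurable_trajectories_component:
  "(\<lambda>\<omega>. \<omega> t) \<in> measurable (trajectories \<mu> \<pi> P) (count_space UNIV)"
  by measurable

lemma distr_trajectories_component:
  "distr (trajectories \<mu> \<pi> P) (count_space UNIV) (\<lambda>\<omega>. \<omega> t) = measure_pmf (pair_law \<mu> \<pi> P t)"
proof (rule measure_eqI)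
  fix A
  assume "A \<in> sets (distr (trajectories \<mu> \<pi> P) (count_space UNIV) (\<lambda>\<omega>. \<omega> t))"
  have "emeasure (distr (trajectories \<mu> \<pi> P) (count_space UNIV) (\<lambda>\<omega>. \<omega> t)) A
      = (\<integral>\<^sup>+x. indicator A x \<partial>distr (trajectories \<mu> \<pi> P) (count_space UNIV) (\<lambda>\<omega>. \<omega> t))"
    by simp
  also have "\<dots> = (\<integral>\<^sup>+\<omega>. indicator A (\<omega> t) \<partial>trajectories \<mu> \<pi> P)"
    by (subst nn_integral_distr) (auto intro: measurable_trajectories_component)
  also have "\<dots> = emeasure (measure_pmf (pair_law \<mu> \<pi> P t)) A"
    by (subst nn_integral_trajectories_component) simp
  finally show "emeasure (distr (trajectories \<mu> \<pi> P) (count_space UNIV) (\<lambda>\<omega>. \<omega> t)) A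
      = emeasure (measure_pmf (pair_law \<mu> \<pi> P t)) A" .
qed simp

text \<open>The image under coordinate 0 is a pmf, and an image measure has the same total
  mass.\<close>

lemma prob_space_trajectories: "prob_space (trajectories \<mu> \<pi> P)"
  by (rule prob_space_distrD[OF measurable_trajectories_component[where t = 0]])
    (simp add: distr_trajectories_component measure_pmf.prob_space_axioms)

lemma integral_trajectories_component:
  fixes f :: "'s::finite \<times> 'a::finite \<Rightarrow> real"
  shows "(\<integral>\<omega>. f (\<omega> t) \<partial>trajectories \<mu> \<pi> P) = measure_pmf.expectation (pair_law \<mu> \<pi> P t) f"
  by (subst distr_trajectories_component[symmetric])
    (simp add: integral_distr[OF measurable_trajectories_component])

lemma prob_trajectories_component:
  "measure (trajectories \<mu> \<pi> P) {\<omega> \<in> space (trajectories \<mu> \<pi> P). \<omega> t \<in> A}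
    = measure_pmf.prob (pair_law \<mu> \<pi> P t) A"
proof -
  have "measure_pmf.prob (pair_law \<mu> \<pi> P t) A
      = measure (distr (trajectories \<mu> \<pi> P) (count_space UNIV) (\<lambda>\<omega>. \<omega> t)) A"
    by (simp add: distr_trajectories_component)
  also have "\<dots> = measure (trajectories \<mu> \<pi> P) {\<omega> \<in> space (trajectories \<mu> \<pi> P). \<omega> t \<in> A}"
    by (subst measure_distr[OF measurable_trajectories_component])
      (auto intro!: arg_cong[where f = "measure _"])
  finally show ?thesis by simp
qed

subsection \<open>Values and visitation measures of a fixed kernel\<close>

lemma finite_cost_bounded:
  fixes c :: "'s::finite \<Rightarrow> 'a::finite \<Rightarrow> real"
  obtains B where "0 \<le> B" "\<And>s a. \<bar>c s a\<bar> \<le> B"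
proof
  show "0 \<le> (\<Sum>x\<in>UNIV. \<bar>c (fst x) (snd x)\<bar>)"
    by (simp add: sum_nonneg)
  show "\<bar>c s a\<bar> \<le> (\<Sum>x\<in>UNIV. \<bar>c (fst x) (snd x)\<bar>)" for s a
    using member_le_sum[of "(s, a)" UNIV "\<lambda>x. \<bar>c (fst x) (snd x)\<bar>"] by simp
qed

lemma expectation_finite:
  fixes f :: "'x::finite \<Rightarrow> real"
  shows "measure_pmf.expectation p f = (\<Sum>x\<in>UNIV. pmf p x * f x)"
  by (subst integral_measure_pmf[of UNIV]) auto

lemma expectation_abs_le:
  fixes f :: "'x::finite \<Rightarrow> real"
  assumes "\<And>x. \<bar>f x\<bar> \<le> B"
  shows "\<bar>measure_pmf.expectation p f\<bar> \<le> B"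
proof -
  have "\<bar>measure_pmf.expectation p f\<bar> \<le> (\<Sum>x\<in>UNIV. pmf p x * B)"
    unfolding expectation_finite
    by (rule order_trans[OF sum_abs]) (auto intro!: sum_mono mult_left_mono assms simp: abs_mult)
  also have "\<dots> = B"
    by (simp add: sum_distrib_right[symmetric] sum_pmf_eq_1)
  finally show ?thesis .
qed

lemma summable_discounted_expectation:
  fixes c :: "'s::finite \<Rightarrow> 'a::finite \<Rightarrow> real"
  assumes "0 \<le> \<gamma>" "\<gamma> < 1"
  shows "summable (\<lambda>t. \<gamma> ^ t * measure_pmf.expectation (q t) (\<lambda>x. c (fst x) (snd x)))"
proof -
  obtain B where B: "0 \<le> B" "\<And>s a. \<bar>c s a\<bar> \<le> B"
    using finite_cost_bounded[of c] by blast
  show ?thesis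
  proof (rule summable_comparison_test')
    show "summable (\<lambda>t. B * \<gamma> ^ t)"
      using assms by (intro summable_mult summable_geometric) auto
    show "norm (\<gamma> ^ t * measure_pmf.expectation (q t) (\<lambda>x. c (fst x) (snd x))) \<le> B * \<gamma> ^ t" for t
      using expectation_abs_le[of "\<lambda>x. c (fst x) (snd x)" B "q t"] B(2) assms(1)
      by (simp add: abs_mult mult.commute[of B] mult_left_mono)
  qed
qed

text \<open>Sum and integral are exchanged under the geometric majorant
  \<open>B * \<gamma> ^ t\<close>. The cost is arbitrary because values are formed later also with
  state indicators and with advantages as costs.\<close>

lemma integral_discounted_cost:
  fixes c :: "'s::finite \<Rightarrow> 'a::finite \<Rightarrow> real"
  assumes \<gamma>: "0 \<le> \<gamma>" "\<gamma> < 1"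
  shows "(\<integral>\<omega>. discounted_cost \<gamma> c \<omega> \<partial>trajectories \<mu> \<pi> P)
    = (\<Sum>t. \<gamma> ^ t * measure_pmf.expectation (pair_law \<mu> \<pi> P t) (\<lambda>x. c (fst x) (snd x)))"
proof -
  let ?T = "trajectories \<mu> \<pi> P" and ?f = "\<lambda>t \<omega>. \<gamma> ^ t * c (fst (\<omega> t)) (snd (\<omega> t))"
  interpret prob_space ?T
    by (rule prob_space_trajectories)
  obtain B where B: "0 \<le> B" "\<And>s a. \<bar>c s a\<bar> \<le> B"
    using finite_cost_bounded[of c] by blast
  have bound: "norm (?f t \<omega>) \<le> B * \<gamma> ^ t" for t \<omega>
    using B(2) \<gamma>(1) by (simp add: abs_mult mult.commute[of B] mult_left_mono)
  have geometric: "summable (\<lambda>t. B * \<gamma> ^ t)"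
    using \<gamma> by (intro summable_mult summable_geometric) auto
  have meas: "?f t \<in> borel_measurable ?T" for t
    using measurable_compose[OF measurable_trajectories_component,
        of "\<lambda>x. \<gamma> ^ t * c (fst x) (snd x)" borel]
    by simp
  have integrable: "integrable ?T (?f t)" for t
    by (rule integrable_const_bound[where B = "B * \<gamma> ^ t"]) (use bound meas in auto)
  have "(\<integral>\<omega>. discounted_cost \<gamma> c \<omega> \<partial>?T) = (\<Sum>t. \<integral>\<omega>. ?f t \<omega> \<partial>?T)"
    unfolding discounted_cost_def
  proof (rule integral_suminf)
    show "AE \<omega> in ?T. summable (\<lambda>t. norm (?f t \<omega>))"
      using bound by (intro AE_I2 summable_comparison_test'[OF geometric]) auto
    have "(\<integral>\<omega>. norm (?f t \<omega>) \<partial>?T) \<le> B * \<gamma> ^ t" for t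
      using integral_mono[OF integrable_norm[OF integrable], of "\<lambda>_. B * \<gamma> ^ t" t] bound
        prob_space
      by simp
    then show "summable (\<lambda>t. \<integral>\<omega>. norm (?f t \<omega>) \<partial>?T)"
      by (intro summable_comparison_test'[OF geometric]) auto
  qed (rule integrable)
  also have "\<dots> = (\<Sum>t. \<gamma> ^ t * measure_pmf.expectation (pair_law \<mu> \<pi> P t) (\<lambda>x. c (fst x) (snd x)))"
    by (simp add: integral_trajectories_component[where f = "\<lambda>x. c (fst x) (snd x)"])
  finally show ?thesis .
qed

text \<open>Linearity in the initial law. Averaging over the first action and averaging over the
  next state are both instances.\<close>

lemma integral_discounted_cost_bind:
  fixes c :: "'s::finite \<Rightarrow> 'a::finite \<Rightarrow> real" and \<mu> :: "'x::finite pmf"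
  assumes \<gamma>: "0 \<le> \<gamma>" "\<gamma> < 1"
  shows "(\<integral>\<omega>. discounted_cost \<gamma> c \<omega> \<partial>trajectories (bind_pmf \<mu> f) \<pi> P)
    = (\<Sum>x\<in>UNIV. pmf \<mu> x * (\<integral>\<omega>. discounted_cost \<gamma> c \<omega> \<partial>trajectories (f x) \<pi> P))"
proof -
  let ?E = "\<lambda>q. measure_pmf.expectation q (\<lambda>x. c (fst x) (snd x))"
  have "(\<Sum>t. \<gamma> ^ t * ?E (pair_law (bind_pmf \<mu> f) \<pi> P t))
      = (\<Sum>t. \<Sum>x\<in>UNIV. pmf \<mu> x * (\<gamma> ^ t * ?E (pair_law (f x) \<pi> P t)))"
    by (simp add: pair_law_bind pmf_expectation_bind[where A = UNIV] sum_distrib_left mult_ac)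
  also have "\<dots> = (\<Sum>x\<in>UNIV. \<Sum>t. pmf \<mu> x * (\<gamma> ^ t * ?E (pair_law (f x) \<pi> P t)))"
    by (intro suminf_sum summable_mult summable_discounted_expectation \<gamma>)
  also have "\<dots> = (\<Sum>x\<in>UNIV. pmf \<mu> x * (\<Sum>t. \<gamma> ^ t * ?E (pair_law (f x) \<pi> P t)))"
    by (intro sum.cong refl suminf_mult summable_discounted_expectation \<gamma>)
  finally show ?thesis
    by (simp only: integral_discounted_cost[OF \<gamma>])
qed

lemma integral_discounted_cost_step:
  fixes c :: "'s::finite \<Rightarrow> 'a::finite \<Rightarrow> real"
  assumes \<gamma>: "0 \<le> \<gamma>" "\<gamma> < 1"
  shows "(\<integral>\<omega>. discounted_cost \<gamma> c \<omega> \<partial>trajectories \<mu> \<pi> P)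
    = measure_pmf.expectation \<mu> (\<lambda>x. c (fst x) (snd x))
      + \<gamma> * (\<integral>\<omega>. discounted_cost \<gamma> c \<omega> \<partial>trajectories (bind_pmf \<mu> (next_pair \<pi> P)) \<pi> P)"
proof -
  let ?E = "\<lambda>q. measure_pmf.expectation q (\<lambda>x. c (fst x) (snd x))"
  have "(\<Sum>t. \<gamma> ^ t * ?E (pair_law \<mu> \<pi> P t))
      = ?E \<mu> + (\<Sum>t. \<gamma> ^ Suc t * ?E (pair_law \<mu> \<pi> P (Suc t)))"
    using suminf_split_head[OF summable_discounted_expectation[OF \<gamma>, of "pair_law \<mu> \<pi> P" c]]
    by simp
  also have "(\<Sum>t. \<gamma> ^ Suc t * ?E (pair_law \<mu> \<pi> P (Suc t)))
      = \<gamma> * (\<Sum>t. \<gamma> ^ t * ?E (pair_law (bind_pmf \<mu> (next_pair \<pi> P)) \<pi> P t))"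
    by (subst suminf_mult[symmetric])
      (auto intro!: summable_discounted_expectation \<gamma> simp: pair_law_Suc_shift mult.assoc
        simp del: pair_law.simps)
  finally show ?thesis
    by (simp only: integral_discounted_cost[OF \<gamma>])
qed

section \<open>Bellman equations and visitation measures\<close>

lemma pmf_vec_pmf:
  assumes "p \<in> prob_simplex"
  shows "pmf (vec_pmf p) i = p $ i"
  unfolding vec_pmf_def
proof (rule pmf_embed_pmf)
  show "0 \<le> p $ i" for i
    using assms by (simp add: prob_simplex_def)
  then have "(\<integral>\<^sup>+i. ennreal (p $ i) \<partial>count_space UNIV) = ennreal (\<Sum>i\<in>UNIV. p $ i)"
    by (simp add: nn_integral_count_space_finite)
  then show "(\<integral>\<^sup>+i. ennreal (p $ i) \<partial>count_space UNIV) = 1"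
    using assms by (simp add: prob_simplex_def)
qed

lemma V_value_eq_sum_Q_value:
  assumes \<gamma>: "0 \<le> \<gamma>" "\<gamma> < 1" and \<pi>: "\<pi> \<in> policies"
  shows "V_value \<gamma> c \<pi> P s = (\<Sum>a\<in>UNIV. \<pi> s $ a * Q_value \<gamma> c \<pi> P s a)"
proof -
  have "initial_state \<pi> s = bind_pmf (vec_pmf (\<pi> s)) (\<lambda>a. return_pmf (s, a))"
    by (simp add: initial_state_def map_pmf_def)
  then show ?thesis
    using \<pi> unfolding V_value_def Q_value_def
    by (simp add: integral_discounted_cost_bind[OF \<gamma>] pmf_vec_pmf policies_def)
qed

lemma Q_value_bellman:
  assumes \<gamma>: "0 \<le> \<gamma>" "\<gamma> < 1" and P: "P \<in> transition_kernels"
  shows "Q_value \<gamma> c \<pi> P s a = c s a + \<gamma> * (\<Sum>s'\<in>UNIV. P s a $ s' * V_value \<gamma> c \<pi> P s')"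
  using P unfolding Q_value_def V_value_def
  by (subst integral_discounted_cost_step[OF \<gamma>])
    (simp add: bind_return_pmf next_pair_def integral_discounted_cost_bind[OF \<gamma>] pmf_vec_pmf
      transition_kernels_def)

text \<open>Reading a visitation probability as the value of an indicator cost lets every fact about
  values apply to visitation measures.\<close>

lemma visitation_from_eq_V_value:
  assumes \<gamma>: "0 \<le> \<gamma>" "\<gamma> < 1"
  shows "visitation_from \<gamma> \<pi> P s s' = (1 - \<gamma>) * V_value \<gamma> (\<lambda>s a. indicator {s'} s) \<pi> P s"
proof -
  have "measure (trajectories \<mu> \<pi> P) {\<omega> \<in> space (trajectories \<mu> \<pi> P). fst (\<omega> t) = s'}
      = measure_pmf.expectation (pair_law \<mu> \<pi> P t) (\<lambda>x. indicator {s'} (fst x))" for t \<mu>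
  proof -
    have "measure (trajectories \<mu> \<pi> P) {\<omega> \<in> space (trajectories \<mu> \<pi> P). fst (\<omega> t) = s'}
        = measure_pmf.prob (pair_law \<mu> \<pi> P t) (fst -` {s'})"
      by (subst prob_trajectories_component[symmetric]) simp
    also have "\<dots> = measure_pmf.expectation (pair_law \<mu> \<pi> P t) (indicator (fst -` {s'}))"
      by simp
    also have "indicator (fst -` {s'}) = (\<lambda>x :: 'a \<times> 'b. indicat_real {s'} (fst x))"
      by (auto simp: indicator_def)
    finally show ?thesis .
  qed
  then show ?thesis
    unfolding visitation_from_def V_value_def Let_def integral_discounted_cost[OF \<gamma>] by simp
qed

text \<open>\<open>F\<close> is the finite combination of the indicators of states with weights
  \<open>F s'\<close>, and the value is linear in the cost. This turns the performance difference
  into an average under the visitation measure.\<close>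

lemma V_value_state_cost:
  assumes \<gamma>: "0 \<le> \<gamma>" "\<gamma> < 1"
  shows "(1 - \<gamma>) * V_value \<gamma> (\<lambda>s a. F s) \<pi> P s
    = (\<Sum>s'\<in>UNIV. visitation_from \<gamma> \<pi> P s s' * F s')"
proof -
  let ?q = "pair_law (initial_state \<pi> s) \<pi> P"
  let ?E = "\<lambda>t s'. measure_pmf.expectation (?q t) (\<lambda>x. indicator {s'} (fst x))"
  have F: "measure_pmf.expectation (?q t) (\<lambda>x. F (fst x)) = (\<Sum>s'\<in>UNIV. F s' * ?E t s')" for t
  proof -
    have "F (fst x) = (\<Sum>s'\<in>UNIV. F s' * indicator {s'} (fst x))" for x :: "'a \<times> 'b"
      by (subst sum.remove[of _ "fst x"]) (auto simp: indicator_def)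
    then have "measure_pmf.expectation (?q t) (\<lambda>x. F (fst x))
        = (\<Sum>x\<in>UNIV. \<Sum>s'\<in>UNIV. pmf (?q t) x * (F s' * indicator {s'} (fst x)))"
      unfolding expectation_finite by (simp only: sum_distrib_left)
    also have "\<dots> = (\<Sum>s'\<in>UNIV. F s' * ?E t s')"
      unfolding expectation_finite by (subst sum.swap) (simp only: sum_distrib_left mult_ac)
    finally show ?thesis .
  qed
  have "V_value \<gamma> (\<lambda>s a. F s) \<pi> P s = (\<Sum>t. \<Sum>s'\<in>UNIV. F s' * (\<gamma> ^ t * ?E t s'))"
    unfolding V_value_def integral_discounted_cost[OF \<gamma>] F by (simp add: sum_distrib_left mult_ac)
  also have "\<dots> = (\<Sum>s'\<in>UNIV. \<Sum>t. F s' * (\<gamma> ^ t * ?E t s'))"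
    by (intro suminf_sum summable_mult
        summable_discounted_expectation[OF \<gamma>, where c = "\<lambda>s a. indicator {_} s"])
  also have "\<dots> = (\<Sum>s'\<in>UNIV. F s' * (\<Sum>t. \<gamma> ^ t * ?E t s'))"
    by (intro sum.cong refl suminf_mult
        summable_discounted_expectation[OF \<gamma>, where c = "\<lambda>s a. indicator {_} s"])
  finally show ?thesis
    unfolding visitation_from_eq_V_value[OF \<gamma>] V_value_def integral_discounted_cost[OF \<gamma>]
    by (simp add: sum_distrib_left mult_ac)
qed

section \<open>Sub- and supersolutions of the Bellman equation\<close>

definition bellman_operator ::
    "real \<Rightarrow> ('s::finite \<Rightarrow> 'a::finite \<Rightarrow> real) \<Rightarrow> ('s, 'a) policy \<Rightarrow> ('s, 'a) kernel \<Rightarrow>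
     ('s \<Rightarrow> real) \<Rightarrow> 's \<Rightarrow> real" where
  "bellman_operator \<gamma> c \<pi> P X s =
     (\<Sum>a\<in>UNIV. \<pi> s $ a * (c s a + \<gamma> * (\<Sum>s'\<in>UNIV. P s a $ s' * X s')))"

lemma prob_simplex_sum_le:
  assumes "p \<in> prob_simplex" "\<And>i. f i \<le> b"
  shows "(\<Sum>i\<in>UNIV. p $ i * f i) \<le> b"
proof -
  have "(\<Sum>i\<in>UNIV. p $ i * f i) \<le> (\<Sum>i\<in>UNIV. p $ i * b)"
    using assms by (intro sum_mono mult_left_mono) (auto simp: prob_simplex_def)
  then show ?thesis
    using assms(1) by (simp add: sum_distrib_right[symmetric] prob_simplex_def)
qed

lemma prob_simplex_sum_mono:
  assumes "p \<in> prob_simplex" "\<And>i. f i \<le> g i"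
  shows "(\<Sum>i\<in>UNIV. p $ i * f i) \<le> (\<Sum>i\<in>UNIV. p $ i * (g i :: real))"
  using assms by (intro sum_mono mult_left_mono) (auto simp: prob_simplex_def)

lemma bellman_operator_mono:
  assumes "0 \<le> \<gamma>" "\<pi> \<in> policies" "P \<in> transition_kernels"
    and "\<And>s. X s \<le> Y s"
  shows "bellman_operator \<gamma> c \<pi> P X s \<le> bellman_operator \<gamma> c \<pi> P Y s"
  using assms unfolding bellman_operator_def
  by (intro prob_simplex_sum_mono add_mono mult_left_mono)
    (auto simp: policies_def transition_kernels_def)

lemma V_value_bellman:
  assumes "0 \<le> \<gamma>" "\<gamma> < 1" "\<pi> \<in> policies" "P \<in> transition_kernels"
  shows "V_value \<gamma> c \<pi> P s = bellman_operator \<gamma> c \<pi> P (V_value \<gamma> c \<pi> P) s"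
  unfolding bellman_operator_def
  by (subst V_value_eq_sum_Q_value) (simp_all add: assms Q_value_bellman)

text \<open>A maximum \<open>m\<close> of \<open>X - Y\<close> satisfies \<open>m \<le> \<gamma> * m\<close>.\<close>

lemma bellman_operator_comparison:
  assumes \<gamma>: "0 \<le> \<gamma>" "\<gamma> < 1" and \<pi>: "\<pi> \<in> policies" and P: "P \<in> transition_kernels"
    and X: "\<And>s. X s \<le> bellman_operator \<gamma> c \<pi> P X s"
    and Y: "\<And>s. bellman_operator \<gamma> c \<pi> P Y s \<le> Y s"
  shows "X s \<le> Y s"
proof -
  define m where "m = Max (range (\<lambda>s. X s - Y s))"
  have le_m: "X s - Y s \<le> m" for s
    unfolding m_def by (rule Max_ge) auto
  have "m \<in> range (\<lambda>s. X s - Y s)"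
    unfolding m_def by (rule Max_in) auto
  then obtain s0 where s0: "X s0 - Y s0 = m"
    by blast
  have "m \<le> bellman_operator \<gamma> c \<pi> P X s0 - bellman_operator \<gamma> c \<pi> P Y s0"
    using X[of s0] Y[of s0] s0 by simp
  also have "\<dots> = (\<Sum>a\<in>UNIV. \<pi> s0 $ a * (\<gamma> * (\<Sum>s'\<in>UNIV. P s0 a $ s' * (X s' - Y s'))))"
    unfolding bellman_operator_def
    by (simp add: sum_subtractf[symmetric] right_diff_distrib[symmetric])
  also have "\<dots> \<le> \<gamma> * m"
    using \<pi> P \<gamma> by (intro prob_simplex_sum_le mult_left_mono le_m)
      (auto simp: policies_def transition_kernels_def)
  finally have "m * (1 - \<gamma>) \<le> 0"
    by (simp add: algebra_simps)
  then have "m \<le> 0"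
    using \<gamma> by (simp add: mult_le_0_iff)
  then show ?thesis
    using le_m[of s] by simp
qed

lemma bellman_operator_const:
  assumes "\<pi> \<in> policies" "P \<in> transition_kernels"
  shows "bellman_operator \<gamma> c \<pi> P (\<lambda>_. b) s = (\<Sum>a\<in>UNIV. \<pi> s $ a * (c s a + \<gamma> * b))"
  using assms
  by (simp add: bellman_operator_def sum_distrib_right[symmetric] transition_kernels_def
      prob_simplex_def)

text \<open>Comparison with constants: 0 is a subsolution, and \<open>1 / (1 - \<gamma>)\<close>,
  the fixed point of \<open>x = 1 + \<gamma> * x\<close>, is a supersolution.\<close>

lemma V_value_bounds:
  assumes \<gamma>: "0 \<le> \<gamma>" "\<gamma> < 1" and \<pi>: "\<pi> \<in> policies" and P: "P \<in> transition_kernels"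
    and c: "\<And>s a. 0 \<le> c s a" "\<And>s a. c s a \<le> 1"
  shows "0 \<le> V_value \<gamma> c \<pi> P s" and "V_value \<gamma> c \<pi> P s \<le> 1 / (1 - \<gamma>)"
proof -
  have \<pi>s: "\<pi> s \<in> prob_simplex" for s
    using \<pi> by (simp add: policies_def)
  show "0 \<le> V_value \<gamma> c \<pi> P s"
  proof (rule bellman_operator_comparison[OF \<gamma> \<pi> P, of "\<lambda>_. 0" c "V_value \<gamma> c \<pi> P"])
    show "0 \<le> bellman_operator \<gamma> c \<pi> P (\<lambda>_. 0) s" for s
      using \<pi>s[of s] c by (simp add: bellman_operator_const[OF \<pi> P] sum_nonneg prob_simplex_def)
  qed (simp add: V_value_bellman[OF \<gamma> \<pi> P, symmetric])
  show "V_value \<gamma> c \<pi> P s \<le> 1 / (1 - \<gamma>)"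
  proof (rule bellman_operator_comparison[OF \<gamma> \<pi> P, of "V_value \<gamma> c \<pi> P" c "\<lambda>_. 1 / (1 - \<gamma>)"])
    have "1 / (1 - \<gamma>) = 1 + \<gamma> * (1 / (1 - \<gamma>))"
      using \<gamma> by (simp add: field_simps)
    then have "c s a + \<gamma> * (1 / (1 - \<gamma>)) \<le> 1 / (1 - \<gamma>)" for s a
      using c(2)[of s a] by linarith
    then show "bellman_operator \<gamma> c \<pi> P (\<lambda>_. 1 / (1 - \<gamma>)) s \<le> 1 / (1 - \<gamma>)" for s
      unfolding bellman_operator_const[OF \<pi> P] by (intro prob_simplex_sum_le \<pi>s)
  qed (simp add: V_value_bellman[OF \<gamma> \<pi> P, symmetric])
qed

text \<open>Indicator costs lie between 0 and 1, so the value bounds apply; the factor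
  \<open>1 - \<gamma>\<close> normalises the upper one to 1.\<close>

lemma visitation_bounds:
  assumes \<gamma>: "0 \<le> \<gamma>" "\<gamma> < 1" and \<pi>: "\<pi> \<in> policies" and P: "P \<in> transition_kernels"
    and \<rho>: "\<rho> \<in> prob_simplex"
  shows "0 \<le> visitation \<gamma> \<pi> P \<rho> s" and "visitation \<gamma> \<pi> P \<rho> s \<le> 1"
proof -
  have "0 \<le> visitation_from \<gamma> \<pi> P s' s \<and> visitation_from \<gamma> \<pi> P s' s \<le> 1" for s'
    using V_value_bounds[OF \<gamma> \<pi> P, of "\<lambda>s' a. indicator {s} s'" s'] \<gamma>
    by (simp add: visitation_from_eq_V_value[OF \<gamma>] pos_le_divide_eq mult.commute[of "1 - \<gamma>"]
        del: indicator_simps)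
  then show "0 \<le> visitation \<gamma> \<pi> P \<rho> s" "visitation \<gamma> \<pi> P \<rho> s \<le> 1"
    using \<rho> unfolding visitation_def
    by (auto intro!: sum_nonneg mult_nonneg_nonneg prob_simplex_sum_le simp: prob_simplex_def)
qed

lemma visitation_le_mismatch:
  assumes u: "u \<in> U" and fin: "mismatch_coefficient \<gamma> PN U \<rho> \<pi> < \<infinity>" and \<rho>: "0 \<le> \<rho> $ s"
  shows "visitation \<gamma> \<pi> (perturbed PN u) \<rho> s
    \<le> enn2real (mismatch_coefficient \<gamma> PN U \<rho> \<pi>) * \<rho> $ s"
proof -
  let ?d = "visitation \<gamma> \<pi> (perturbed PN u) \<rho> s" and ?M = "mismatch_coefficient \<gamma> PN U \<rho> \<pi>"
  have ratio: "ennreal ?d / ennreal (\<rho> $ s) \<le> ?M"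
    unfolding mismatch_coefficient_def by (rule SUP_upper2[OF u], rule SUP_upper) simp
  have M: "?M = ennreal (enn2real ?M)"
    using fin by (simp add: less_top)
  show ?thesis
  proof (cases "\<rho> $ s = 0")
    \<comment> \<open>A positive numerator over 0 would make the ratio infinite, so finiteness of
      the coefficient forces \<open>ennreal ?d = 0\<close>.\<close>
    case True
    with ratio fin have "ennreal ?d = 0"
      by (cases "ennreal ?d = 0") (auto simp: ennreal_divide_zero top_unique)
    then show ?thesis
      using True by (simp add: ennreal_eq_0_iff)
  next
    case False
    with \<rho> have pos: "0 < \<rho> $ s" by simp
    show ?thesis
    proof (cases "0 \<le> ?d")
      case True
      with pos ratio have "ennreal (?d / \<rho> $ s) \<le> ennreal (enn2real ?M)"
        using M by (simp add: divide_ennreal)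
      then show ?thesis
        using pos by (simp add: ennreal_le_iff field_simps)
    next
      \<comment> \<open>\<open>ennreal\<close> truncates negative reals to 0, so the ratio says
        nothing here; the right-hand side is nonnegative anyway.\<close>
      case False
      then show ?thesis
        using \<rho> by (meson enn2real_nonneg linear mult_nonneg_nonneg order_trans)
    qed
  qed
qed

subsection \<open>Robust values\<close>

locale robust_mdp =
  fixes \<gamma> :: real and c :: "'s::finite \<Rightarrow> 'a::finite \<Rightarrow> real"
    and PN :: "('s, 'a) kernel" and U :: "('s, 'a) kernel set"
  assumes discount: "0 < \<gamma>" "\<gamma> < 1"
    and cost: "\<And>s a. 0 \<le> c s a" "\<And>s a. c s a \<le> 1"
    and U_nonempty: "U \<noteq> {}" and U_compact: "compact U" and U_rectangular: "rectangular U"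
    and kernels: "\<And>u. u \<in> U \<Longrightarrow> perturbed PN u \<in> transition_kernels"
begin

abbreviation "V \<equiv> V_robust \<gamma> c PN U"
abbreviation "Q \<equiv> Q_robust \<gamma> c PN U"

lemma discount_nonneg: "0 \<le> \<gamma>"
  using discount by simp

lemmas [simp] = discount_nonneg discount(2)

text \<open>For each pair \<open>s\<close>, \<open>a\<close> the expected next value is continuous
  in the kernel and attains its maximum on the compact set \<open>U\<close>. Rectangularity allows
  the maximisers of the different pairs to be glued into one element of \<open>U\<close>.\<close>

lemma exists_worst_kernel:
  obtains u where "u \<in> U"
    and "\<And>v s a. v \<in> U \<Longrightarrow> (\<Sum>s'\<in>UNIV. perturbed PN v s a $ s' * X s')
      \<le> (\<Sum>s'\<in>UNIV. perturbed PN u s a $ s' * X s')"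
proof -
  have "\<exists>w\<in>U. \<forall>v\<in>U. (\<Sum>s'\<in>UNIV. perturbed PN v s a $ s' * X s')
      \<le> (\<Sum>s'\<in>UNIV. perturbed PN w s a $ s' * X s')" for s a
  proof (rule continuous_attains_sup[OF U_compact U_nonempty])
    \<comment> \<open>Kernels are functions, so \<open>compact U\<close> refers to the product
      topology, in which evaluation is continuous.\<close>
    have "continuous_on U (\<lambda>u :: ('s, 'a) kernel. u s)"
      by (rule continuous_on_product_then_coordinatewise[OF continuous_on_id])
    then have "continuous_on U (\<lambda>u :: ('s, 'a) kernel. u s a)"
      by (rule continuous_on_product_then_coordinatewise)
    then show "continuous_on U (\<lambda>u. \<Sum>s'\<in>UNIV. perturbed PN u s a $ s' * X s')"
      unfolding perturbed_def by (intro continuous_intros)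
  qed
  then obtain w where w: "\<And>s a. w s a \<in> U"
    "\<And>s a v. v \<in> U \<Longrightarrow> (\<Sum>s'\<in>UNIV. perturbed PN v s a $ s' * X s')
      \<le> (\<Sum>s'\<in>UNIV. perturbed PN (w s a) s a $ s' * X s')"
    by metis
  show thesis
  proof
    show "(\<lambda>s a. w s a s a) \<in> U"
      using U_rectangular w(1) unfolding rectangular_def by blast
    show "(\<Sum>s'\<in>UNIV. perturbed PN v s a $ s' * X s')
      \<le> (\<Sum>s'\<in>UNIV. perturbed PN (\<lambda>s a. w s a s a) s a $ s' * X s')" if "v \<in> U" for v s a
      using w(2)[OF that, of s a] by (simp add: perturbed_def)
  qed
qed

lemma V_value_le_V:
  assumes "\<pi> \<in> policies" "u \<in> U"
  shows "V_value \<gamma> c \<pi> (perturbed PN u) s \<le> V \<pi> s"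
  unfolding V_robust_def
proof (rule cSUP_upper[OF assms(2)])
  show "bdd_above ((\<lambda>u. V_value \<gamma> c \<pi> (perturbed PN u) s) ` U)"
    using V_value_bounds(2)[OF _ _ assms(1) kernels] cost
    by (intro bdd_aboveI2[where M = "1 / (1 - \<gamma>)"]) auto
qed

lemma V_bounds:
  assumes "\<pi> \<in> policies"
  shows "0 \<le> V \<pi> s" and "V \<pi> s \<le> 1 / (1 - \<gamma>)"
proof -
  obtain u where "u \<in> U"
    using U_nonempty by blast
  then show "0 \<le> V \<pi> s"
    using V_value_bounds(1)[OF _ _ assms kernels[of u], of \<gamma> c s] cost V_value_le_V[OF assms, of u s]
    by simp
  show "V \<pi> s \<le> 1 / (1 - \<gamma>)"
    unfolding V_robust_def using V_value_bounds(2)[OF _ _ assms kernels] cost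
    by (intro cSUP_least U_nonempty) auto
qed

text \<open>
  The supremum \<open>V \<pi>\<close> is a subsolution of the Bellman equation of the kernel that is worst for
  \<open>V \<pi>\<close>, so that by comparison this single kernel attains it at every state. No fixed point of
  the robust Bellman operator has to be constructed.
\<close>

lemma robust_bellman:
  assumes \<pi>: "\<pi> \<in> policies"
  obtains u where "u \<in> U"
    and "\<And>v s a. v \<in> U \<Longrightarrow> (\<Sum>s'\<in>UNIV. perturbed PN v s a $ s' * V \<pi> s')
      \<le> (\<Sum>s'\<in>UNIV. perturbed PN u s a $ s' * V \<pi> s')"
    and "\<And>s. V \<pi> s = bellman_operator \<gamma> c \<pi> (perturbed PN u) (V \<pi>) s"
    and "\<And>s a. Q \<pi> s $ a = c s a + \<gamma> * (\<Sum>s'\<in>UNIV. perturbed PN u s a $ s' * V \<pi> s')"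
proof -
  obtain u where u: "u \<in> U"
    and worst: "\<And>v s a. v \<in> U \<Longrightarrow> (\<Sum>s'\<in>UNIV. perturbed PN v s a $ s' * V \<pi> s')
      \<le> (\<Sum>s'\<in>UNIV. perturbed PN u s a $ s' * V \<pi> s')"
    by (rule exists_worst_kernel[of "V \<pi>"], rule that)
  have V_le: "V_value \<gamma> c \<pi> (perturbed PN v) s \<le> V \<pi> s" if "v \<in> U" for v s
    by (rule V_value_le_V[OF \<pi> that])
  have P: "perturbed PN v s a \<in> prob_simplex" if "v \<in> U" for v s a
    using kernels[OF that] by (simp add: transition_kernels_def)
  have sub: "V \<pi> s \<le> bellman_operator \<gamma> c \<pi> (perturbed PN u) (V \<pi>) s" for s
    unfolding V_robust_def[of _ _ _ _ _ s]
  proof (intro cSUP_least U_nonempty)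
    fix v
    assume v: "v \<in> U"
    have "V_value \<gamma> c \<pi> (perturbed PN v) s \<le> bellman_operator \<gamma> c \<pi> (perturbed PN v) (V \<pi>) s"
      by (subst V_value_bellman) (simp_all add: \<pi> kernels v bellman_operator_mono V_le)
    also have "\<dots> \<le> bellman_operator \<gamma> c \<pi> (perturbed PN u) (V \<pi>) s"
      unfolding bellman_operator_def using \<pi>
      by (intro prob_simplex_sum_mono add_left_mono mult_left_mono worst v)
        (auto simp: policies_def)
    finally show "V_value \<gamma> c \<pi> (perturbed PN v) s
        \<le> bellman_operator \<gamma> c \<pi> (perturbed PN u) (V \<pi>) s" .
  qed
  \<comment> \<open>The value of the kernel \<open>u\<close> solves its own Bellman equation, hence
    is a supersolution to compare with \<open>V \<pi>\<close>.\<close>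
  have "V \<pi> s \<le> V_value \<gamma> c \<pi> (perturbed PN u) s" for s
    by (rule bellman_operator_comparison[OF _ _ \<pi> kernels[OF u], of \<gamma> _ c])
      (simp_all add: sub V_value_bellman[OF _ _ \<pi> kernels[OF u], symmetric])
  then have V_eq: "V_value \<gamma> c \<pi> (perturbed PN u) = V \<pi>"
    using V_le[OF u] by (intro ext antisym)
  have Q_eq: "Q_value \<gamma> c \<pi> (perturbed PN v) s a
      = c s a + \<gamma> * (\<Sum>s'\<in>UNIV. perturbed PN v s a $ s' * V_value \<gamma> c \<pi> (perturbed PN v) s')"
    if "v \<in> U" for v s a
    by (simp add: Q_value_bellman kernels that)
  \<comment> \<open>The same \<open>u\<close> attains every \<open>Q\<close> value: for another
    kernel \<open>v\<close>, first its continuation values are at most \<open>V \<pi>\<close>, then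
    \<open>u\<close> maximises the average of \<open>V \<pi>\<close>.\<close>
  have "Q \<pi> s $ a = c s a + \<gamma> * (\<Sum>s'\<in>UNIV. perturbed PN u s a $ s' * V \<pi> s')" for s a
    unfolding Q_robust_def vec_lambda_beta
  proof (rule cSup_eq_maximum)
    show "c s a + \<gamma> * (\<Sum>s'\<in>UNIV. perturbed PN u s a $ s' * V \<pi> s')
        \<in> (\<lambda>u. Q_value \<gamma> c \<pi> (perturbed PN u) s a) ` U"
      using Q_eq[OF u] V_eq u by (intro image_eqI[of _ _ u]) simp_all
    fix q
    assume "q \<in> (\<lambda>u. Q_value \<gamma> c \<pi> (perturbed PN u) s a) ` U"
    then obtain v where v: "v \<in> U" and q: "q = Q_value \<gamma> c \<pi> (perturbed PN v) s a"
      by blast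
    have "(\<Sum>s'\<in>UNIV. perturbed PN v s a $ s' * V_value \<gamma> c \<pi> (perturbed PN v) s')
        \<le> (\<Sum>s'\<in>UNIV. perturbed PN v s a $ s' * V \<pi> s')"
      by (intro prob_simplex_sum_mono P V_le v)
    also have "\<dots> \<le> (\<Sum>s'\<in>UNIV. perturbed PN u s a $ s' * V \<pi> s')"
      by (rule worst[OF v])
    finally show "q \<le> c s a + \<gamma> * (\<Sum>s'\<in>UNIV. perturbed PN u s a $ s' * V \<pi> s')"
      unfolding q Q_eq[OF v] by (intro add_left_mono mult_left_mono) simp_all
  qed
  moreover have "V \<pi> s = bellman_operator \<gamma> c \<pi> (perturbed PN u) (V \<pi>) s" for s
    using V_value_bellman[OF _ _ \<pi> kernels[OF u], of \<gamma> c s] by (simp add: V_eq)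
  ultimately show thesis
    using that u worst by blast
qed

section \<open>Comparison of policies through the robust Q-function\<close>

lemma inner_Q_eq:
  assumes "\<And>s a. Q \<pi> s $ a = c s a + \<gamma> * (\<Sum>s'\<in>UNIV. P s a $ s' * V \<pi> s')"
  shows "inner (Q \<pi> s) (\<pi>' s) = bellman_operator \<gamma> c \<pi>' P (V \<pi>) s"
  by (simp add: inner_vec_def bellman_operator_def assms mult.commute)

lemma V_eq_inner_Q:
  assumes "\<pi> \<in> policies"
  shows "V \<pi> s = inner (Q \<pi> s) (\<pi> s)"
proof -
  obtain u where "\<And>s. V \<pi> s = bellman_operator \<gamma> c \<pi> (perturbed PN u) (V \<pi>) s"
    and "\<And>s a. Q \<pi> s $ a = c s a + \<gamma> * (\<Sum>s'\<in>UNIV. perturbed PN u s a $ s' * V \<pi> s')"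
    by (rule robust_bellman[OF assms], rule that)
  then show ?thesis
    using inner_Q_eq[of \<pi> "perturbed PN u" s \<pi>] by simp
qed

text \<open>\<open>Q \<pi>\<close> is built with the kernel that is worst for \<open>V \<pi>\<close>
  at all pairs simultaneously, whatever policy then weights the actions.\<close>

lemma bellman_operator_le_inner_Q:
  assumes "\<pi> \<in> policies" "\<pi>' \<in> policies" "v \<in> U"
  shows "bellman_operator \<gamma> c \<pi>' (perturbed PN v) (V \<pi>) s \<le> inner (Q \<pi> s) (\<pi>' s)"
proof -
  obtain u where worst: "\<And>v s a. v \<in> U \<Longrightarrow> (\<Sum>s'\<in>UNIV. perturbed PN v s a $ s' * V \<pi> s')
      \<le> (\<Sum>s'\<in>UNIV. perturbed PN u s a $ s' * V \<pi> s')"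
    and Q: "\<And>s a. Q \<pi> s $ a = c s a + \<gamma> * (\<Sum>s'\<in>UNIV. perturbed PN u s a $ s' * V \<pi> s')"
    by (rule robust_bellman[OF assms(1)], rule that)
  show ?thesis
    unfolding inner_Q_eq[OF Q] unfolding bellman_operator_def using assms(2)
    by (intro prob_simplex_sum_mono add_left_mono mult_left_mono worst assms(3))
      (auto simp: policies_def)
qed

text \<open>With \<open>v\<close> worst for the new policy, \<open>V \<pi>'\<close> solves a Bellman
  equation exactly, while the sign condition makes \<open>V \<pi>\<close> a supersolution of
  it.\<close>

lemma policy_improvement:
  assumes \<pi>: "\<pi> \<in> policies" and \<pi>': "\<pi>' \<in> policies"
    and improve: "\<And>s. inner (Q \<pi> s) (\<pi>' s - \<pi> s) \<le> 0"
  shows "V \<pi>' s - V \<pi> s \<le> inner (Q \<pi> s) (\<pi>' s - \<pi> s)"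
proof -
  obtain v where v: "v \<in> U"
    and V': "\<And>s. V \<pi>' s = bellman_operator \<gamma> c \<pi>' (perturbed PN v) (V \<pi>') s"
    by (rule robust_bellman[OF \<pi>'], rule that)
  have le: "bellman_operator \<gamma> c \<pi>' (perturbed PN v) (V \<pi>) s
      \<le> V \<pi> s + inner (Q \<pi> s) (\<pi>' s - \<pi> s)" for s
    using bellman_operator_le_inner_Q[OF \<pi> \<pi>' v, of s]
    by (simp add: V_eq_inner_Q[OF \<pi>, of s] inner_diff_right)
  have "V \<pi>' s \<le> V \<pi> s" for s
  proof (rule bellman_operator_comparison[OF _ _ \<pi>' kernels[OF v], of \<gamma> _ c])
    show "bellman_operator \<gamma> c \<pi>' (perturbed PN v) (V \<pi>) s \<le> V \<pi> s" for s
      using le[of s] improve[of s] by linarith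
  qed (simp_all add: V'[symmetric])
  \<comment> \<open>Inserting the order just obtained into the equation for \<open>V \<pi>'\<close>
    once more upgrades it to the quantitative bound.\<close>
  then have "V \<pi>' s \<le> bellman_operator \<gamma> c \<pi>' (perturbed PN v) (V \<pi>) s"
    by (subst V') (simp add: bellman_operator_mono \<pi>' kernels v)
  then show ?thesis
    using le[of s] by linarith
qed

text \<open>For the kernel that is worst for \<open>V \<pi>\<close>, the Bellman equation of
  \<open>\<pi>\<close> is exact and \<open>V \<pi>'\<close> is a supersolution for
  \<open>\<pi>'\<close>. So the difference is a subsolution of the evaluation equation whose cost is
  the advantage.\<close>

lemma performance_difference:
  assumes \<pi>: "\<pi> \<in> policies" and \<pi>': "\<pi>' \<in> policies"
  obtains u where "u \<in> U"
    and "\<And>s. V \<pi> s - V \<pi>' s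
      \<le> V_value \<gamma> (\<lambda>s a. inner (Q \<pi> s) (\<pi> s - \<pi>' s)) \<pi>' (perturbed PN u) s"
proof -
  obtain u where u: "u \<in> U"
    and Q: "\<And>s a. Q \<pi> s $ a = c s a + \<gamma> * (\<Sum>s'\<in>UNIV. perturbed PN u s a $ s' * V \<pi> s')"
    by (rule robust_bellman[OF \<pi>], rule that)
  let ?P = "perturbed PN u" and ?F = "\<lambda>s (a :: 'a). inner (Q \<pi> s) (\<pi> s - \<pi>' s)"
  have sub: "V \<pi> s - V \<pi>' s \<le> bellman_operator \<gamma> ?F \<pi>' ?P (\<lambda>s. V \<pi> s - V \<pi>' s) s" for s
  proof -
    have "(\<Sum>a\<in>UNIV. \<pi>' s $ a) = 1"
      using \<pi>' by (simp add: policies_def prob_simplex_def)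
    \<comment> \<open>\<open>?F\<close> ignores its action argument; \<open>undefined\<close> only
      fills that slot.\<close>
    then have "bellman_operator \<gamma> ?F \<pi>' ?P (\<lambda>s. V \<pi> s - V \<pi>' s) s
        = ?F s undefined + bellman_operator \<gamma> c \<pi>' ?P (V \<pi>) s - bellman_operator \<gamma> c \<pi>' ?P (V \<pi>') s"
      unfolding bellman_operator_def
      by (simp add: distrib_left right_diff_distrib sum.distrib sum_subtractf
          sum_distrib_right[symmetric])
    moreover have "bellman_operator \<gamma> c \<pi>' ?P (V \<pi>') s \<le> V \<pi>' s"
      using bellman_operator_le_inner_Q[OF \<pi>' \<pi>' u] V_eq_inner_Q[OF \<pi>'] by simp
    moreover have "V \<pi> s = ?F s undefined + bellman_operator \<gamma> c \<pi>' ?P (V \<pi>) s"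
      using V_eq_inner_Q[OF \<pi>, of s] inner_Q_eq[OF Q, of s \<pi>'] by (simp add: inner_diff_right)
    ultimately show ?thesis
      by linarith
  qed
  have "V \<pi> s - V \<pi>' s \<le> V_value \<gamma> ?F \<pi>' ?P s" for s
    by (rule bellman_operator_comparison[OF _ _ \<pi>' kernels[OF u] sub])
      (simp_all add: V_value_bellman[OF _ _ \<pi>' kernels[OF u], symmetric])
  then show thesis
    using that u by blast
qed

end

subsection \<open>Policy mirror descent\<close>

text \<open>First-order optimality along the segment from \<open>q\<close> to \<open>p\<close>. The
  objective is quadratic in the segment parameter, so a negative slope is refuted by an explicit
  point of the segment. The factor 2 is the derivative of the squared norm.\<close>

lemma prox_variational_inequality:
  fixes x p q y :: "real ^ 'a::finite"
  assumes min: "is_arg_min (\<lambda>p. \<eta> * inner y p + bregman (\<lambda>_. p) \<pi> s) (\<lambda>p. p \<in> prob_simplex) q"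
    and p: "p \<in> prob_simplex"
  shows "\<eta> * inner y (q - p) \<le> 2 * inner (q - \<pi> s) (p - q)"
proof (rule ccontr)
  \<comment> \<open>\<open>A\<close> is the directional derivative of the objective at
    \<open>q\<close> towards \<open>p\<close>, and \<open>N\<close> the coefficient of the quadratic
    term.\<close>
  define A where "A = \<eta> * inner y (p - q) + 2 * inner (q - \<pi> s) (p - q)"
  define N where "N = inner (p - q) (p - q)"
  assume "\<not> \<eta> * inner y (q - p) \<le> 2 * inner (q - \<pi> s) (p - q)"
  then have A: "A < 0"
    by (simp add: A_def inner_diff_right algebra_simps)
  have q: "q \<in> prob_simplex"
    using min by (simp add: is_arg_min_def)
  have ineq: "0 \<le> t * A + t\<^sup>2 * N" if t: "0 \<le> t" "t \<le> 1" for t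
  proof -
    have "(\<Sum>i\<in>UNIV. q $ i + t * (p $ i - q $ i)) = 1"
      using p q by (simp add: prob_simplex_def sum.distrib sum_subtractf sum_distrib_left[symmetric])
    moreover have "0 \<le> q $ i + t * (p $ i - q $ i)" for i
    proof -
      have "0 \<le> (1 - t) * q $ i + t * p $ i"
        using p q t by (simp add: prob_simplex_def)
      then show ?thesis
        by (simp add: algebra_simps)
    qed
    ultimately have "q + t *\<^sub>R (p - q) \<in> prob_simplex"
      by (simp add: prob_simplex_def)
    then have "\<eta> * inner y q + (norm (q - \<pi> s))\<^sup>2
        \<le> \<eta> * inner y (q + t *\<^sub>R (p - q)) + (norm (q + t *\<^sub>R (p - q) - \<pi> s))\<^sup>2"
      using min unfolding is_arg_min_linorder bregman_def by blast
    also have "q + t *\<^sub>R (p - q) - \<pi> s = (q - \<pi> s) + t *\<^sub>R (p - q)"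
      by simp
    also have "(norm ((q - \<pi> s) + t *\<^sub>R (p - q)))\<^sup>2
        = (norm (q - \<pi> s))\<^sup>2 + 2 * t * inner (q - \<pi> s) (p - q) + t\<^sup>2 * N"
      unfolding N_def power2_norm_eq_inner inner_add_left inner_add_right
      by (simp add: inner_commute power2_eq_square)
    finally show ?thesis
      by (simp add: A_def inner_add_right algebra_simps)
  qed
  have "0 < N"
    using ineq[of 1] A by simp
  \<comment> \<open>This is the minimiser of \<open>t * A + t\<^sup>2 * N\<close>; it lies in the
    segment because \<open>ineq\<close> at 1 gives \<open>- A \<le> N\<close>.\<close>
  moreover have "- A / (2 * N) \<le> 1"
    using ineq[of 1] A \<open>0 < N\<close> by (simp add: field_simps)
  ultimately have "0 \<le> - A / (2 * N) * A + (- A / (2 * N))\<^sup>2 * N"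
    using A by (intro ineq) (auto simp: divide_le_0_iff)
  also have "\<dots> = - (A\<^sup>2 / (4 * N))"
    using \<open>0 < N\<close> by (simp add: field_simps power2_eq_square)
  also have "\<dots> < 0"
    using A \<open>0 < N\<close> by (simp add: divide_pos_pos)
  finally show False
    by simp
qed

lemma norm_prob_simplex_le: "p \<in> prob_simplex \<Longrightarrow> norm (p :: real ^ 'a::finite) \<le> 1"
  using norm_le_l1_cart[of p] by (simp add: prob_simplex_def)

lemma sum_le_sqrt_sum_squares:
  fixes f :: "nat \<Rightarrow> real"
  assumes "(\<Sum>t<k. (f t)\<^sup>2) \<le> b"
  shows "(\<Sum>t<k. f t) \<le> sqrt (real k * b)"
proof (rule real_le_rsqrt)
  have "(\<Sum>t<k. f t)\<^sup>2 \<le> (\<Sum>t<k. (f t)\<^sup>2) * real k"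
    using sum_squared_le_sum_of_squares[of f "{..<k}"] by simp
  also have "\<dots> \<le> b * real k"
    using assms by (rule mult_right_mono) simp
  finally show "(\<Sum>t<k. f t)\<^sup>2 \<le> real k * b"
    by (simp add: mult.commute)
qed

section \<open>Progress of the iterates with a constant stepsize\<close>

locale rpmd_iteration = robust_mdp +
  fixes \<eta> :: real and \<pi> :: "nat \<Rightarrow> ('a, 'b) policy"
  assumes stepsize: "0 < \<eta>" and iterates: "rpmd \<gamma> c PN U (\<lambda>_. \<eta>) \<pi>"
begin

lemma iterate_prob_simplex: "\<pi> t s \<in> prob_simplex"
  using iterates by (cases t) (auto simp: rpmd_def policies_def is_arg_min_def)

lemma iterate_policies: "\<pi> t \<in> policies"
  by (simp add: policies_def iterate_prob_simplex)

lemma iterate_variational_inequality: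
  assumes "p \<in> prob_simplex"
  shows "\<eta> * inner (Q (\<pi> t) s) (\<pi> (Suc t) s - p)
    \<le> 2 * inner (\<pi> (Suc t) s - \<pi> t s) (p - \<pi> (Suc t) s)"
  using iterates assms unfolding rpmd_def by (blast intro: prox_variational_inequality)

text \<open>Tested with the current iterate, the right-hand side of the variational inequality is
  minus twice the squared step.\<close>

lemma iterate_descent:
  "2 / \<eta> * (norm (\<pi> (Suc t) s - \<pi> t s))\<^sup>2 \<le> inner (Q (\<pi> t) s) (\<pi> t s - \<pi> (Suc t) s)"
proof -
  have "\<eta> * inner (Q (\<pi> t) s) (\<pi> t s - \<pi> (Suc t) s) \<ge> 2 * (norm (\<pi> (Suc t) s - \<pi> t s))\<^sup>2"
    using iterate_variational_inequality[OF iterate_prob_simplex[of t s], of t s]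
    by (simp add: power2_norm_eq_inner inner_diff_right inner_diff_left inner_commute algebra_simps)
  then show ?thesis
    using stepsize by (simp add: field_simps)
qed

text \<open>Descent holds at every state, which is the sign condition of
  \<open>policy_improvement\<close>.\<close>

lemma iterate_improvement:
  "inner (Q (\<pi> t) s) (\<pi> t s - \<pi> (Suc t) s) \<le> V (\<pi> t) s - V (\<pi> (Suc t)) s"
proof -
  have "inner (Q (\<pi> t) s) (\<pi> (Suc t) s - \<pi> t s) \<le> 0" for s
  proof -
    have "0 \<le> 2 / \<eta> * (norm (\<pi> (Suc t) s - \<pi> t s))\<^sup>2"
      using stepsize by simp
    then show ?thesis
      using iterate_descent[of t s] by (simp add: inner_diff_right)
  qed
  then show ?thesis
    using policy_improvement[OF iterate_policies iterate_policies, of t "Suc t" s]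
    by (simp add: inner_diff_right)
qed

lemma V_antimono: "V (\<pi> (Suc t)) s \<le> V (\<pi> t) s"
proof -
  have "0 \<le> 2 / \<eta> * (norm (\<pi> (Suc t) s - \<pi> t s))\<^sup>2"
    using stepsize by simp
  then show ?thesis
    using iterate_descent[of t s] iterate_improvement[of t s] by linarith
qed

lemma sum_step_norms_le:
  "(\<Sum>t<k. norm (\<pi> (Suc t) s - \<pi> t s)) \<le> sqrt (real k * (\<eta> / (2 * (1 - \<gamma>))))"
proof (rule sum_le_sqrt_sum_squares)
  have "(norm (\<pi> (Suc t) s - \<pi> t s))\<^sup>2 \<le> \<eta> / 2 * (V (\<pi> t) s - V (\<pi> (Suc t)) s)" for t
    using order_trans[OF iterate_descent iterate_improvement, of t s] stepsize
    by (simp add: field_simps)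
  then have "(\<Sum>t<k. (norm (\<pi> (Suc t) s - \<pi> t s))\<^sup>2)
      \<le> (\<Sum>t<k. \<eta> / 2 * (V (\<pi> t) s - V (\<pi> (Suc t)) s))"
    by (rule sum_mono)
  also have "\<dots> = \<eta> / 2 * (V (\<pi> 0) s - V (\<pi> k) s)"
    unfolding sum_distrib_left[symmetric]
    by (subst sum_lessThan_telescope'[of "\<lambda>t. V (\<pi> t) s"]) simp
  also have "\<dots> \<le> \<eta> / 2 * (1 / (1 - \<gamma>))"
    using V_bounds[OF iterate_policies, of 0 s] V_bounds[OF iterate_policies, of k s] stepsize
    by (intro mult_left_mono) auto
  finally show "(\<Sum>t<k. (norm (\<pi> (Suc t) s - \<pi> t s))\<^sup>2) \<le> \<eta> / (2 * (1 - \<gamma>))"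
    by simp
qed

text \<open>Split \<open>\<pi> t s - p\<close> at the next iterate: the first part is controlled by
  improvement, the second by the variational inequality and Cauchy-Schwarz. The 4 is its factor 2
  times the bound 2 for the distance of two points of the simplex.\<close>

lemma advantage_le:
  assumes p: "p \<in> prob_simplex"
  shows "inner (Q (\<pi> t) s) (\<pi> t s - p)
    \<le> V (\<pi> t) s - V (\<pi> (Suc t)) s + 4 / \<eta> * norm (\<pi> (Suc t) s - \<pi> t s)"
proof -
  have "inner (\<pi> (Suc t) s - \<pi> t s) (p - \<pi> (Suc t) s)
      \<le> norm (\<pi> (Suc t) s - \<pi> t s) * norm (p - \<pi> (Suc t) s)"
    by (rule norm_cauchy_schwarz)
  also have "norm (p - \<pi> (Suc t) s) \<le> 2"
    using norm_triangle_ineq4[of p "\<pi> (Suc t) s"] norm_prob_simplex_le[OF p]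
      norm_prob_simplex_le[OF iterate_prob_simplex[of "Suc t" s]] by linarith
  finally have "inner (\<pi> (Suc t) s - \<pi> t s) (p - \<pi> (Suc t) s)
      \<le> norm (\<pi> (Suc t) s - \<pi> t s) * 2"
    by (simp add: mult_left_mono)
  then have "\<eta> * inner (Q (\<pi> t) s) (\<pi> (Suc t) s - p) \<le> 4 * norm (\<pi> (Suc t) s - \<pi> t s)"
    using iterate_variational_inequality[OF p, of t s] by linarith
  then have "inner (Q (\<pi> t) s) (\<pi> (Suc t) s - p) \<le> 4 / \<eta> * norm (\<pi> (Suc t) s - \<pi> t s)"
    using stepsize by (simp add: field_simps)
  then show ?thesis
    using iterate_improvement[of t s] by (simp add: inner_diff_right)
qed

text \<open>The kernel behind the gap varies with \<open>t\<close>. Only bounds uniform over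
  \<open>U\<close> remain in the conclusion, so that it can be summed over \<open>t\<close>.\<close>

lemma objective_gap_le:
  fixes \<rho> :: "real ^ 'a"
  defines "f \<equiv> robust_objective \<gamma> c PN U \<rho>"
  assumes \<rho>: "\<rho> \<in> prob_simplex" and \<sigma>: "\<sigma> \<in> policies"
    and fin: "mismatch_coefficient \<gamma> PN U \<rho> \<sigma> < \<infinity>"
  shows "(1 - \<gamma>) * (f (\<pi> t) - f \<sigma>)
    \<le> enn2real (mismatch_coefficient \<gamma> PN U \<rho> \<sigma>) * (f (\<pi> t) - f (\<pi> (Suc t)))
      + 4 / \<eta> * (\<Sum>s\<in>UNIV. norm (\<pi> (Suc t) s - \<pi> t s))"
proof -
  let ?M = "enn2real (mismatch_coefficient \<gamma> PN U \<rho> \<sigma>)"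
  let ?F = "\<lambda>s. inner (Q (\<pi> t) s) (\<pi> t s - \<sigma> s)"
  let ?e = "\<lambda>s. norm (\<pi> (Suc t) s - \<pi> t s)"
  let ?D = "\<lambda>s. V (\<pi> t) s - V (\<pi> (Suc t)) s"
  obtain u where u: "u \<in> U"
    and gap: "\<And>s. V (\<pi> t) s - V \<sigma> s \<le> V_value \<gamma> (\<lambda>s a. ?F s) \<sigma> (perturbed PN u) s"
    using performance_difference[OF iterate_policies[of t] \<sigma>] by blast
  let ?d = "visitation \<gamma> \<sigma> (perturbed PN u) \<rho>"
  have d: "0 \<le> ?d s" "?d s \<le> 1" for s
    using visitation_bounds[OF _ _ \<sigma> kernels[OF u] \<rho>] by simp_all
  have "f (\<pi> t) - f \<sigma> = (\<Sum>s\<in>UNIV. \<rho> $ s * (V (\<pi> t) s - V \<sigma> s))"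
    by (simp add: f_def robust_objective_def sum_subtractf right_diff_distrib)
  also have "\<dots> \<le> (\<Sum>s\<in>UNIV. \<rho> $ s * V_value \<gamma> (\<lambda>s a. ?F s) \<sigma> (perturbed PN u) s)"
    by (intro prob_simplex_sum_mono \<rho> gap)
  finally have "(1 - \<gamma>) * (f (\<pi> t) - f \<sigma>)
      \<le> (1 - \<gamma>) * (\<Sum>s\<in>UNIV. \<rho> $ s * V_value \<gamma> (\<lambda>s a. ?F s) \<sigma> (perturbed PN u) s)"
    by (intro mult_left_mono) (auto simp: less_imp_le)
  also have "\<dots> = (\<Sum>s\<in>UNIV. \<rho> $ s * (\<Sum>s'\<in>UNIV. visitation_from \<gamma> \<sigma> (perturbed PN u) s s' * ?F s'))"
    by (simp add: sum_distrib_left mult.left_commute[of "1 - \<gamma>"] V_value_state_cost)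
  \<comment> \<open>Summing over the initial state first produces the visitation measure started
    from \<open>\<rho>\<close>.\<close>
  also have "\<dots> = (\<Sum>s'\<in>UNIV. ?d s' * ?F s')"
    unfolding visitation_def sum_distrib_left sum_distrib_right
    by (subst sum.swap) (simp only: mult_ac)
  also have "\<dots> \<le> (\<Sum>s\<in>UNIV. ?M * (\<rho> $ s * ?D s) + 4 / \<eta> * ?e s)"
  proof (rule sum_mono)
    fix s
    have "?d s * ?F s \<le> ?d s * (?D s + 4 / \<eta> * ?e s)"
      using \<sigma> by (intro mult_left_mono advantage_le d) (simp add: policies_def)
    also have "\<dots> = ?d s * ?D s + ?d s * (4 / \<eta> * ?e s)"
      by (rule distrib_left)
    also have "?d s * ?D s \<le> ?M * \<rho> $ s * ?D s"
      using V_antimono[of t s] \<rho>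
      by (intro mult_right_mono visitation_le_mismatch u fin) (auto simp: prob_simplex_def)
    also have "?d s * (4 / \<eta> * ?e s) \<le> 4 / \<eta> * ?e s"
      using stepsize by (intro mult_left_le_one_le d) auto
    finally show "?d s * ?F s \<le> ?M * (\<rho> $ s * ?D s) + 4 / \<eta> * ?e s"
      by (simp add: mult.assoc)
  qed
  also have "\<dots> = ?M * (f (\<pi> t) - f (\<pi> (Suc t))) + 4 / \<eta> * (\<Sum>s\<in>UNIV. ?e s)"
    by (simp add: f_def robust_objective_def sum_subtractf right_diff_distrib sum.distrib
        sum_distrib_left)
  finally show ?thesis .
qed

lemma robust_objective_antimono:
  assumes "\<rho> \<in> prob_simplex" "t \<le> k"
  shows "robust_objective \<gamma> c PN U \<rho> (\<pi> k) \<le> robust_objective \<gamma> c PN U \<rho> (\<pi> t)"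
proof -
  have "V (\<pi> k) s \<le> V (\<pi> t) s" for s
    by (rule lift_Suc_antimono_le[of "\<lambda>t. V (\<pi> t) s", OF V_antimono assms(2)])
  then show ?thesis
    unfolding robust_objective_def by (intro prob_simplex_sum_mono assms(1))
qed

lemma convergence_rate:
  fixes \<rho> :: "real ^ 'a"
  defines "f \<equiv> robust_objective \<gamma> c PN U \<rho>"
  assumes \<rho>: "\<rho> \<in> prob_simplex" and \<sigma>: "\<sigma> \<in> policies" and le: "f \<sigma> \<le> f (\<pi> k)"
    and fin: "mismatch_coefficient \<gamma> PN U \<rho> \<sigma> < \<infinity>" and k: "1 \<le> k"
  shows "f (\<pi> k) - f \<sigma>
    \<le> enn2real (mismatch_coefficient \<gamma> PN U \<rho> \<sigma>) / ((1 - \<gamma>) * real k) * (f (\<pi> 0) - f \<sigma>)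
      + sqrt (8 * (real CARD('a))\<^sup>2 / (\<eta> * real k * (1 - \<gamma>) ^ 3))"
proof -
  let ?M = "enn2real (mismatch_coefficient \<gamma> PN U \<rho> \<sigma>)"
  define r where "r = sqrt (real k * (\<eta> / (2 * (1 - \<gamma>))))"
  have pos: "0 < (1 - \<gamma>) * real k"
    using discount k by simp
  have "(1 - \<gamma>) * real k * (f (\<pi> k) - f \<sigma>) = (\<Sum>t<k. (1 - \<gamma>) * (f (\<pi> k) - f \<sigma>))"
    by simp
  \<comment> \<open>The objective decreases along the iterates, so the gap at the last one is at
    most each earlier gap.\<close>
  also have "\<dots> \<le> (\<Sum>t<k. (1 - \<gamma>) * (f (\<pi> t) - f \<sigma>))"
    using robust_objective_antimono[OF \<rho>] discount unfolding f_def
    by (intro sum_mono mult_left_mono) (auto simp: less_imp_le)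
  also have "\<dots> \<le> (\<Sum>t<k. ?M * (f (\<pi> t) - f (\<pi> (Suc t)))
      + 4 / \<eta> * (\<Sum>s\<in>UNIV. norm (\<pi> (Suc t) s - \<pi> t s)))"
    unfolding f_def by (intro sum_mono objective_gap_le \<rho> \<sigma> fin)
  also have "\<dots> = ?M * (f (\<pi> 0) - f (\<pi> k))
      + 4 / \<eta> * (\<Sum>s\<in>UNIV. \<Sum>t<k. norm (\<pi> (Suc t) s - \<pi> t s))"
    unfolding sum.distrib sum_distrib_left[symmetric] sum_lessThan_telescope'[of "\<lambda>t. f (\<pi> t)"]
    by (subst sum.swap) simp
  \<comment> \<open>The end point of the telescoped sum is replaced through
    \<open>f \<sigma> \<le> f (\<pi> k)\<close>; \<open>r\<close> bounds the total step length at
    each single state.\<close>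
  also have "\<dots> \<le> ?M * (f (\<pi> 0) - f \<sigma>) + 4 / \<eta> * (\<Sum>s\<in>(UNIV :: 'a set). r)"
    using le stepsize unfolding r_def
    by (intro add_mono mult_left_mono sum_mono sum_step_norms_le) auto
  finally have "f (\<pi> k) - f \<sigma>
      \<le> (?M * (f (\<pi> 0) - f \<sigma>) + 4 / \<eta> * (real CARD('a) * r)) / ((1 - \<gamma>) * real k)"
    using pos by (simp add: pos_le_divide_eq mult.commute)
  also have "\<dots> = ?M / ((1 - \<gamma>) * real k) * (f (\<pi> 0) - f \<sigma>)
      + 4 / \<eta> * (real CARD('a) * r) / ((1 - \<gamma>) * real k)"
    by (simp add: add_divide_distrib)
  also have "4 / \<eta> * (real CARD('a) * r) / ((1 - \<gamma>) * real k)
      = sqrt (8 * (real CARD('a))\<^sup>2 / (\<eta> * real k * (1 - \<gamma>) ^ 3))"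
  proof (rule real_sqrt_unique[symmetric])
    \<comment> \<open>The letters \<open>n\<close>, \<open>x\<close>, \<open>g\<close> stand for the
      number of states, \<open>k\<close> and \<open>1 - \<gamma>\<close>. The constant arises as
      \<open>4\<^sup>2 / 2 = 8\<close>, the 2 coming from \<open>r\<^sup>2\<close>.\<close>
    have "(4 / \<eta> * (n * r) / (g * x))\<^sup>2 = 8 * n\<^sup>2 / (\<eta> * x * g ^ 3)"
      if "r\<^sup>2 = x * (\<eta> / (2 * g))" "0 < g" "0 < x" for g x n :: real
      unfolding power_divide power_mult_distrib that(1) using stepsize that(2,3)
      by (simp add: field_simps power2_eq_square power3_eq_cube)
    moreover have "r\<^sup>2 = real k * (\<eta> / (2 * (1 - \<gamma>)))"
      unfolding r_def using stepsize
      by (intro real_sqrt_pow2 mult_nonneg_nonneg divide_nonneg_nonneg) (auto simp: less_imp_le)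
    ultimately show "(4 / \<eta> * (real CARD('a) * r) / ((1 - \<gamma>) * real k))\<^sup>2
        = 8 * (real CARD('a))\<^sup>2 / (\<eta> * real k * (1 - \<gamma>) ^ 3)"
      using k by simp
    show "0 \<le> 4 / \<eta> * (real CARD('a) * r) / ((1 - \<gamma>) * real k)"
      unfolding r_def using stepsize
      by (intro mult_nonneg_nonneg divide_nonneg_nonneg) (auto simp: less_imp_le)
  qed
  finally show ?thesis .
qed

end

theorem theorem3p2:
  fixes c :: "'s::finite \<Rightarrow> 'a::finite \<Rightarrow> real"
    and \<gamma> \<eta> :: real
    and PN :: "('s, 'a) kernel"
    and U :: "('s, 'a) kernel set"
    and \<rho> :: "real ^ 's"
    and \<pi>opt :: "('s, 'a) policy"
    and \<pi> :: "nat \<Rightarrow> ('s, 'a) policy"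
    and M :: ennreal
    and k :: nat
  assumes cost: "\<And>s a. 0 < c s a \<and> c s a \<le> 1"
    and discount: "0 < \<gamma>" "\<gamma> < 1"
    and nominal: "PN \<in> transition_kernels"
    and uncertainty: "U \<noteq> {}" "compact U" "rectangular U"
    and kernels: "\<And>u. u \<in> U \<Longrightarrow> perturbed PN u \<in> transition_kernels"
    and rho: "\<rho> \<in> prob_simplex"
    and opt: "optimal_robust_policy \<gamma> c PN U \<pi>opt"
    and M: "M = mismatch_coefficient \<gamma> PN U \<rho> \<pi>opt" "M < \<infinity>"
    and stepsize: "0 < \<eta>"
    and iterates: "rpmd \<gamma> c PN U (\<lambda>_. \<eta>) \<pi>"
    and k: "1 \<le> k"
  shows "robust_objective \<gamma> c PN U \<rho> (\<pi> k) - robust_objective \<gamma> c PN U \<rho> \<pi>opt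
    \<le> enn2real M / ((1 - \<gamma>) * real k)
        * (robust_objective \<gamma> c PN U \<rho> (\<pi> 0) - robust_objective \<gamma> c PN U \<rho> \<pi>opt)
      + sqrt (18 * (real CARD('s))\<^sup>2 / (\<eta> * real k * (1 - \<gamma>) ^ 3))"
proof -
  interpret rpmd_iteration \<gamma> c PN U \<eta> \<pi>
    by unfold_locales (use cost in \<open>auto simp: discount uncertainty kernels stepsize iterates less_imp_le\<close>)
  have \<pi>opt: "\<pi>opt \<in> policies"
    and "\<And>s. V \<pi>opt s \<le> V (\<pi> k) s"
    using opt iterate_policies by (auto simp: optimal_robust_policy_def)
  then have "robust_objective \<gamma> c PN U \<rho> \<pi>opt \<le> robust_objective \<gamma> c PN U \<rho> (\<pi> k)"
    unfolding robust_objective_def by (intro prob_simplex_sum_mono rho)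
  then have "robust_objective \<gamma> c PN U \<rho> (\<pi> k) - robust_objective \<gamma> c PN U \<rho> \<pi>opt
      \<le> enn2real M / ((1 - \<gamma>) * real k)
          * (robust_objective \<gamma> c PN U \<rho> (\<pi> 0) - robust_objective \<gamma> c PN U \<rho> \<pi>opt)
        + sqrt (8 * (real CARD('s))\<^sup>2 / (\<eta> * real k * (1 - \<gamma>) ^ 3))"
    using convergence_rate[OF rho \<pi>opt _ _ k] M by simp
  also have "sqrt (8 * (real CARD('s))\<^sup>2 / (\<eta> * real k * (1 - \<gamma>) ^ 3))
      \<le> sqrt (18 * (real CARD('s))\<^sup>2 / (\<eta> * real k * (1 - \<gamma>) ^ 3))"
    using stepsize discount by (intro real_sqrt_le_mono divide_right_mono) (auto simp: less_imp_le)
  finally show ?thesis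
    by simp
qed

end
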